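(* Let $\mathcal{S}\subseteq\{0,1\}^n$ be a set of vectors such that for every $i\in[n]$ there exist $v,w\in\mathcal{S}$ with $v_i=1$ and $w_i=0$. A vector $v\in\{0,1\}^n$ belongs to $Cl_{S_{10}}(\mathcal{S})$ if and only if (1) there exists $w\in\mathcal{S}$ with $\mathbb{1}(v)\subseteq\mathbb{1}(w)$, and (2) for all $(k,i)\in\mathbb{1}(v)\times\mathbb{0}(v)$ there exists $w\in\mathcal{S}$ with $(w_k,w_i)=(1,0)$.
   Context: For $v\in\{0,1\}^n$, $\mathbb{1}(v)=\{i\mid v_i=1\}$ and $\mathbb{0}(v)=\{i\mid v_i=0\}$. Boolean operations act on vectors coordinate-wise. $S_{10}$ is the clone generated by the ternary operation $x\wedge(y\vee z)$, and $Cl_{S_{10}}(\mathcal{S})$ is the smallest set of vectors containing $\mathcal{S}$ and closed under $(x,y,z)\mapsto x\wedge(y\vee z)$ (applied coordinate-wise). *)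

theory Defs
  imports Main "HOL-Library.FuncSet"
begin

text \<open>
  Vectors in $\{0,1\}^n$ are extensional functions on the index set $[n] = \{1,\dots,n\}$,
  with truth values for the entries (\<^term>\<open>True\<close> is 1, \<^term>\<open>False\<close> is 0);
  extensionality makes equality of functions coincide with equality of vectors.
\<close>

definition vectors :: "nat \<Rightarrow> (nat \<Rightarrow> bool) set" where
  "vectors n = ({1..n} \<rightarrow>\<^sub>E UNIV)"

definition ones :: "nat \<Rightarrow> (nat \<Rightarrow> bool) \<Rightarrow> nat set" where
  "ones n v = {i \<in> {1..n}. v i = True}"

definition zeros :: "nat \<Rightarrow> (nat \<Rightarrow> bool) \<Rightarrow> nat set" where
  "zeros n v = {i \<in> {1..n}. v i = False}"

definition op_S10 :: "bool \<Rightarrow> bool \<Rightarrow> bool \<Rightarrow> bool" where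
  "op_S10 x y z \<longleftrightarrow> x \<and> (y \<or> z)"

definition coordwise3 ::
  "nat \<Rightarrow> (bool \<Rightarrow> bool \<Rightarrow> bool \<Rightarrow> bool)
    \<Rightarrow> (nat \<Rightarrow> bool) \<Rightarrow> (nat \<Rightarrow> bool) \<Rightarrow> (nat \<Rightarrow> bool) \<Rightarrow> (nat \<Rightarrow> bool)" where
  "coordwise3 n f x y z = (\<lambda>i\<in>{1..n}. f (x i) (y i) (z i))"

inductive_set Cl_S10 :: "nat \<Rightarrow> (nat \<Rightarrow> bool) set \<Rightarrow> (nat \<Rightarrow> bool) set"
  for n :: nat and S :: "(nat \<Rightarrow> bool) set" where
  base: "v \<in> S \<Longrightarrow> v \<in> Cl_S10 n S"
| step: "x \<in> Cl_S10 n S \<Longrightarrow> y \<in> Cl_S10 n S \<Longrightarrow> z \<in> Cl_S10 n S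
    \<Longrightarrow> coordwise3 n op_S10 x y z \<in> Cl_S10 n S"

end

theory Submission
  imports Defs
begin

text \<open>
  Both conditions are preserved by $x \wedge (y \vee z)$. Conversely, let $w$ dominate $v$ as in
  (1) and let $w_{k,i}$ be as in (2). For a zero $i$ of $v$, iterating $u \mapsto w \wedge (u \vee w_{k,i})$
  over the ones $k$ of $v$, starting from a vector vanishing at $i$, produces a vector that
  dominates $v$ and vanishes at $i$. The meet of these vectors with $w$ is $v$, and meets are
  available as $x \wedge y = x \wedge (y \vee y)$.
\<close>

lemma coordwise3_op_S10_apply:
  "i \<in> {1..n} \<Longrightarrow> coordwise3 n op_S10 x y z i \<longleftrightarrow> x i \<and> (y i \<or> z i)"
  by (simp add: coordwise3_def op_S10_def)

lemma ones_coordwise3_op_S10: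
  "ones n (coordwise3 n op_S10 x y z) = ones n x \<inter> (ones n y \<union> ones n z)"
  by (auto simp: ones_def coordwise3_op_S10_apply)

lemma Cl_S10_subset_vectors:
  assumes "S \<subseteq> vectors n"
  shows "Cl_S10 n S \<subseteq> vectors n"
proof
  fix x assume "x \<in> Cl_S10 n S"
  then show "x \<in> vectors n"
    by induction (use assms in \<open>auto simp: vectors_def coordwise3_def\<close>)
qed

text \<open>Both functions are \<open>undefined\<close> outside \<open>{1..n}\<close>, and inside it
  the set of ones fixes a Boolean vector.\<close>

lemma vectors_eqI:
  assumes "u \<in> vectors n" "v \<in> vectors n" "ones n u = ones n v"
  shows "u = v"
  using assms(1,2) unfolding vectors_def
  by (rule PiE_ext) (use assms(3) in \<open>auto simp: ones_def\<close>)

lemma Cl_S10_dominated: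
  "x \<in> Cl_S10 n S \<Longrightarrow> \<exists>w\<in>S. ones n x \<subseteq> ones n w"
  by (induction rule: Cl_S10.induct) (auto simp: ones_coordwise3_op_S10)

text \<open>Suppose x \<and> (y \<or> z) is 1 at \<open>k\<close> and 0 at \<open>i\<close>. Then x
  is 1 at \<open>k\<close>. If x is 0 at \<open>i\<close>, it separates already; otherwise y and z
  both vanish at \<open>i\<close>, and one of them is 1 at \<open>k\<close>.\<close>

lemma Cl_S10_separated:
  assumes "x \<in> Cl_S10 n S" "k \<in> {1..n}" "i \<in> {1..n}" "x k" "\<not> x i"
  shows "\<exists>w\<in>S. w k \<and> \<not> w i"
  using assms
  by (induction rule: Cl_S10.induct) (auto simp: coordwise3_op_S10_apply simp del: atLeastAtMost_iff)

text \<open>Induction on \<open>K\<close>: passing from \<open>u\<close> to \<open>w\<close> \<and>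
  (\<open>u\<close> \<or> \<open>x\<close>) adds the new one \<open>k\<close>. The meet with
  \<open>w\<close> destroys no required one, and \<open>i\<close> stays a zero because
  \<open>u\<close> and \<open>x\<close> both vanish there, whatever \<open>w\<close> does.\<close>

lemma Cl_S10_vanishing_at:
  assumes "finite K" "w \<in> Cl_S10 n S" "K \<subseteq> ones n w" "i \<in> {1..n}"
    and "x0 \<in> S" "\<not> x0 i"
    and "\<forall>k\<in>K. \<exists>x\<in>S. x k \<and> \<not> x i"
  shows "\<exists>u\<in>Cl_S10 n S. K \<subseteq> ones n u \<and> i \<notin> ones n u"
  using assms
proof (induction K rule: finite_induct)
  case empty
  \<comment> \<open>The start of the iteration is \<open>x0\<close>, of which only the zero at
    \<open>i\<close> matters.\<close>
  then show ?case by (auto simp: ones_def intro: Cl_S10.base)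
next
  case (insert k K)
  then obtain u where u: "u \<in> Cl_S10 n S" "K \<subseteq> ones n u" "i \<notin> ones n u"
    by auto
  obtain x where x: "x \<in> S" "x k" "\<not> x i"
    using insert.prems by auto
  have "coordwise3 n op_S10 w u x \<in> Cl_S10 n S"
    using insert.prems(1) u(1) x(1) by (blast intro: Cl_S10.intros)
  moreover have "k \<in> ones n x" "i \<notin> ones n x"
    using x insert.prems(2) by (auto simp: ones_def)
  ultimately show ?case
    using u insert.prems(2)
    by (intro bexI[of _ "coordwise3 n op_S10 w u x"]) (auto simp: ones_coordwise3_op_S10)
qed

text \<open>A meet keeps the common ones \<open>K\<close> and collects the zeros of both factors, so
  one meet per element of \<open>I\<close> suffices.\<close>

lemma Cl_S10_vanishing_on:
  assumes "finite I" "w \<in> Cl_S10 n S" "K \<subseteq> ones n w"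
    and "\<forall>i\<in>I. \<exists>u\<in>Cl_S10 n S. K \<subseteq> ones n u \<and> i \<notin> ones n u"
  shows "\<exists>u\<in>Cl_S10 n S. K \<subseteq> ones n u \<and> I \<inter> ones n u = {}"
  using assms
proof (induction I rule: finite_induct)
  case empty
  \<comment> \<open>The empty meet is represented by \<open>w\<close>.\<close>
  then show ?case by auto
next
  case (insert i I)
  then obtain u where u: "u \<in> Cl_S10 n S" "K \<subseteq> ones n u" "I \<inter> ones n u = {}"
    by auto
  obtain x where x: "x \<in> Cl_S10 n S" "K \<subseteq> ones n x" "i \<notin> ones n x"
    using insert.prems by auto
  have "coordwise3 n op_S10 u x x \<in> Cl_S10 n S"
    using u(1) x(1) by (blast intro: Cl_S10.step)
  then show ?case
    using u x
    by (intro bexI[of _ "coordwise3 n op_S10 u x x"]) (auto simp: ones_coordwise3_op_S10)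
qed

theorem theorem5:
  fixes n :: nat and S :: "(nat \<Rightarrow> bool) set" and v :: "nat \<Rightarrow> bool"
  assumes "S \<subseteq> vectors n"
    and "\<forall>i\<in>{1..n}. \<exists>u\<in>S. \<exists>w\<in>S. u i = True \<and> w i = False"
    and "v \<in> vectors n"
  shows "v \<in> Cl_S10 n S \<longleftrightarrow>
    (\<exists>w\<in>S. ones n v \<subseteq> ones n w) \<and>
    (\<forall>(k, i) \<in> ones n v \<times> zeros n v. \<exists>w\<in>S. (w k, w i) = (True, False))"
    (is "_ \<longleftrightarrow> ?dominated \<and> ?separated")
proof
  assume v: "v \<in> Cl_S10 n S"
  then have ?separated
    using Cl_S10_separated[OF v] by (auto simp: ones_def zeros_def)
  with Cl_S10_dominated[OF v] show "?dominated \<and> ?separated" by blast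
next
  assume asm: "?dominated \<and> ?separated"
  then obtain w where w: "w \<in> Cl_S10 n S" "ones n v \<subseteq> ones n w"
    by (blast intro: Cl_S10.base)
  have fin: "finite (ones n v)" "finite (zeros n v)"
    by (simp_all add: ones_def zeros_def)
  have "\<forall>i\<in>zeros n v. \<exists>u\<in>Cl_S10 n S. ones n v \<subseteq> ones n u \<and> i \<notin> ones n u"
  proof
    fix i assume i: "i \<in> zeros n v"
    then have i_le: "i \<in> {1..n}" by (simp add: zeros_def)
    \<comment> \<open>If \<open>v\<close> has no ones, condition (2) is vacuous; the vector
      vanishing at \<open>i\<close> comes from the assumption on \<open>S\<close> instead.\<close>
    then obtain x0 where x0: "x0 \<in> S" "\<not> x0 i" using assms(2) by blast
    have "\<forall>k\<in>ones n v. \<exists>x\<in>S. x k \<and> \<not> x i" using asm i by auto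
    from Cl_S10_vanishing_at[OF fin(1) w i_le x0 this]
    show "\<exists>u\<in>Cl_S10 n S. ones n v \<subseteq> ones n u \<and> i \<notin> ones n u" .
  qed
  from Cl_S10_vanishing_on[OF fin(2) w this] obtain u
    where u: "u \<in> Cl_S10 n S" "ones n v \<subseteq> ones n u" "zeros n v \<inter> ones n u = {}"
    by blast
  \<comment> \<open>\<open>ones n v\<close> and \<open>zeros n v\<close> partition
    \<open>{1..n}\<close>, so avoiding the zeros of \<open>v\<close> gives the reverse
    inclusion.\<close>
  then have "ones n u = ones n v" by (auto simp: ones_def zeros_def)
  then have "u = v"
    using vectors_eqI u(1) Cl_S10_subset_vectors[OF assms(1)] assms(3) by blast
  with u(1) show "v \<in> Cl_S10 n S" by simp
qed

end
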